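(* Let $n\ge4$ and assume every clean triple is nondegenerate. Let the row weights satisfy $w_f\ge w_{\mathrm g}>0$ for $f\in\mathcal C_0$ and $0\le w_f\le w_{\mathrm b}<\infty$ for $f\in\mathcal C_b$. If $$w_{\mathrm g}\Big(\frac n2-6\Delta_E\Big)>6w_{\mathrm b}\Delta_E ,$$ equivalently $$\frac{\Delta_E}{n}<\frac{w_{\mathrm g}}{12(w_{\mathrm g}+w_{\mathrm b})},$$ then every global minimizer $z^\sharp\in\mathbb R^T$ of $$F_1(z)=\sum_{f\in\mathcal C}w_f|r_f(z)|$$ recovers all clean triangle log-scales up to a common additive constant: there is $\alpha\in\mathbb R$ with $z_t^\sharp=z_t^\star+\alpha$ for all $t\in T_0$. In particular, for the unweighted objective ($w_f\equiv1$), and also for weights $w_f=\sqrt{\pi_t\pi_u}$ (for the row joining $t,u$) with $\pi_t=1$ for $t\in T_0$ and $0\le\pi_t\le1$ for $t\in T_b$, one may take $w_{\mathrm g}=w_{\mathrm b}=1$, and the sufficient condition becomes $\Delta_E<n/24$.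
   Context: Setting. There are $n$ cameras with distinct locations $x_1^\star,\dots,x_n^\star\in\mathbb R^3$; $\ell_{ij}^\star=\|x_i^\star-x_j^\star\|$. The edges of $K_n$ are partitioned as $E(K_n)=E_0\sqcup E_b$ (clean / corrupted), $\Delta_E=\max_i\deg_{E_b}(i)$. Each edge carries a unit vector $d_{ij}\in\mathbb R^3$ ($d_{ji}=-d_{ij}$): for $ij\in E_0$, $d_{ij}=(x_i^\star-x_j^\star)/\ell_{ij}^\star$; for $ij\in E_b$, $d_{ij}$ is arbitrary. For a triple $t=\{i<j<k\}$ put $a=d_{ij}$, $b=d_{jk}$, $c=d_{ki}$, and $h_{t,ij}=\|b\times c\|$, $h_{t,jk}=\|c\times a\|$, $h_{t,ki}=\|a\times b\|$; $t$ is nondegenerate if these are all positive. $T$ is the set of all nondegenerate triples (retained triangles). A triple is clean if its three edges lie in $E_0$. $T_0\subset T$ is the set of clean triples, $T_b=T\setminus T_0$. For $t\in T_0$, $s_t^\star>0$ is the unique number with $s_t^\star h_{t,e}=\ell_e^\star$ for all edges $e\subset t$, and $z_t^\star=\log s_t^\star$. The row set $\mathcal C$ contains one row $f$, with fixed orientation $(t,u)$, for each unordered pair of distinct retained triangles sharing a camera edge $e$; its residual is $r_f(z)=z_u-z_t-\log(h_{t,e}/h_{u,e})$, $z\in\mathbb R^T$. $\mathcal C_0$ is the set of rows with both endpoints in $T_0$, and $\mathcal C_b=\mathcal C\setminus\mathcal C_0$. *)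

theory Defs
  imports "HOL-Analysis.Analysis"
begin

text \<open>Cameras are the indices in \<open>{1..n}\<close>. An undirected camera edge is encoded by its increasing
  pair \<open>(i, j)\<close> with \<open>i < j\<close>, and a triple \<open>{i < j < k}\<close> by \<open>(i, j, k)\<close>.\<close>

type_synonym camera_edge = "nat \<times> nat"
type_synonym triple = "nat \<times> nat \<times> nat"
type_synonym row = "triple \<times> triple"

definition complete_edges :: "nat \<Rightarrow> camera_edge set" where
  "complete_edges n = {(i, j). 1 \<le> i \<and> i < j \<and> j \<le> n}"

definition edge_degree :: "camera_edge set \<Rightarrow> nat \<Rightarrow> nat" where
  "edge_degree E i = card {e \<in> E. fst e = i \<or> snd e = i}"

definition max_degree :: "nat \<Rightarrow> camera_edge set \<Rightarrow> nat" where
  "max_degree n E = Max (edge_degree E ` {1..n})"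

definition camera_dist :: "(nat \<Rightarrow> real^3) \<Rightarrow> camera_edge \<Rightarrow> real" where
  "camera_dist x e = norm (x (fst e) - x (snd e))"

definition triples :: "nat \<Rightarrow> triple set" where
  "triples n = {(i, j, k). 1 \<le> i \<and> i < j \<and> j < k \<and> k \<le> n}"

fun tri_edges :: "triple \<Rightarrow> camera_edge set" where
  "tri_edges (i, j, k) = {(i, j), (j, k), (i, k)}"

text \<open>The value 0 off the three edges of the triple is a dummy.\<close>

fun height :: "(nat \<Rightarrow> nat \<Rightarrow> real^3) \<Rightarrow> triple \<Rightarrow> camera_edge \<Rightarrow> real" where
  "height d (i, j, k) e =
    (let a = d i j; b = d j k; c = d k i in
     if e = (i, j) then norm (cross3 b c)
     else if e = (j, k) then norm (cross3 c a)
     else if e = (i, k) then norm (cross3 a b)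
     else 0)"

definition nondegenerate :: "(nat \<Rightarrow> nat \<Rightarrow> real^3) \<Rightarrow> triple \<Rightarrow> bool" where
  "nondegenerate d t \<longleftrightarrow> (\<forall>e \<in> tri_edges t. height d t e > 0)"

definition retained :: "nat \<Rightarrow> (nat \<Rightarrow> nat \<Rightarrow> real^3) \<Rightarrow> triple set" where
  "retained n d = {t \<in> triples n. nondegenerate d t}"

definition clean :: "camera_edge set \<Rightarrow> triple \<Rightarrow> bool" where
  "clean E0 t \<longleftrightarrow> tri_edges t \<subseteq> E0"

definition clean_retained ::
  "nat \<Rightarrow> camera_edge set \<Rightarrow> (nat \<Rightarrow> nat \<Rightarrow> real^3) \<Rightarrow> triple set" where
  "clean_retained n E0 d = {t \<in> retained n d. clean E0 t}"

definition true_scale ::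
  "(nat \<Rightarrow> real^3) \<Rightarrow> (nat \<Rightarrow> nat \<Rightarrow> real^3) \<Rightarrow> triple \<Rightarrow> real" where
  "true_scale x d t =
    (THE s. s > 0 \<and> (\<forall>e \<in> tri_edges t. s * height d t e = camera_dist x e))"

definition true_log_scale ::
  "(nat \<Rightarrow> real^3) \<Rightarrow> (nat \<Rightarrow> nat \<Rightarrow> real^3) \<Rightarrow> triple \<Rightarrow> real" where
  "true_log_scale x d t = ln (true_scale x d t)"

definition adjacent :: "triple \<Rightarrow> triple \<Rightarrow> bool" where
  "adjacent t u \<longleftrightarrow> t \<noteq> u \<and> tri_edges t \<inter> tri_edges u \<noteq> {}"

text \<open>Two distinct triples share at most one edge.\<close>

definition shared_edge :: "triple \<Rightarrow> triple \<Rightarrow> camera_edge" where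
  "shared_edge t u = (THE e. e \<in> tri_edges t \<inter> tri_edges u)"

text \<open>\<open>C\<close> contains, for each unordered pair of distinct retained triples sharing an edge, exactly
  one of its two orientations, and nothing else.\<close>

definition row_set :: "nat \<Rightarrow> (nat \<Rightarrow> nat \<Rightarrow> real^3) \<Rightarrow> row set \<Rightarrow> bool" where
  "row_set n d C \<longleftrightarrow>
    (\<forall>(t, u) \<in> C. t \<in> retained n d \<and> u \<in> retained n d \<and> adjacent t u) \<and>
    (\<forall>t \<in> retained n d. \<forall>u \<in> retained n d. adjacent t u \<longrightarrow> ((t, u) \<in> C \<longleftrightarrow> (u, t) \<notin> C))"

definition clean_rows ::
  "nat \<Rightarrow> camera_edge set \<Rightarrow> (nat \<Rightarrow> nat \<Rightarrow> real^3) \<Rightarrow> row set \<Rightarrow> row set" where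
  "clean_rows n E0 d C = {(t, u) \<in> C. t \<in> clean_retained n E0 d \<and> u \<in> clean_retained n E0 d}"

definition residual ::
  "(nat \<Rightarrow> nat \<Rightarrow> real^3) \<Rightarrow> (triple \<Rightarrow> real) \<Rightarrow> row \<Rightarrow> real" where
  "residual d z = (\<lambda>(t, u).
    z u - z t - ln (height d t (shared_edge t u) / height d u (shared_edge t u)))"

definition L1_objective ::
  "(nat \<Rightarrow> nat \<Rightarrow> real^3) \<Rightarrow> row set \<Rightarrow> (row \<Rightarrow> real) \<Rightarrow> (triple \<Rightarrow> real) \<Rightarrow> real" where
  "L1_objective d C w z = (\<Sum>f\<in>C. w f * \<bar>residual d z f\<bar>)"

text \<open>The bound \<open>0 \<le> wb\<close> is required even when there are no corrupted rows.\<close>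

definition admissible_weights ::
  "nat \<Rightarrow> camera_edge set \<Rightarrow> (nat \<Rightarrow> nat \<Rightarrow> real^3) \<Rightarrow> row set \<Rightarrow>
    real \<Rightarrow> real \<Rightarrow> (row \<Rightarrow> real) \<Rightarrow> bool" where
  "admissible_weights n E0 d C wg wb w \<longleftrightarrow>
    0 < wg \<and> 0 \<le> wb \<and>
    (\<forall>f \<in> clean_rows n E0 d C. wg \<le> w f) \<and>
    (\<forall>f \<in> C - clean_rows n E0 d C. 0 \<le> w f \<and> w f \<le> wb)"

text \<open>Vectors indexed by the retained triples are extensional functions on that set.\<close>

definition exact_recovery ::
  "nat \<Rightarrow> (nat \<Rightarrow> real^3) \<Rightarrow> camera_edge set \<Rightarrow> (nat \<Rightarrow> nat \<Rightarrow> real^3) \<Rightarrow> row set \<Rightarrow>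
    (row \<Rightarrow> real) \<Rightarrow> bool" where
  "exact_recovery n x E0 d C w \<longleftrightarrow>
    (\<forall>z. is_arg_min (L1_objective d C w) (\<lambda>z. z \<in> retained n d \<rightarrow>\<^sub>E UNIV) z \<longrightarrow>
      (\<exists>\<alpha>. \<forall>t \<in> clean_retained n E0 d. z t = true_log_scale x d t + \<alpha>))"

end

theory Submission
  imports Defs "HOL-Combinatorics.Permutations"
begin

text \<open>The graph of all camera triples, adjacent when they share an edge, is the Johnson graph
  \<open>J(n, 3)\<close>, which satisfies an \<open>L\<^sup>1\<close> Poincare inequality with constant \<open>n\<close>: route a pair of triples
  along a shortest path and average over all permutations of the cameras; by distance transitivity
  every edge of the graph carries the same load. A clean triple has at most \<open>6 \<Delta>\<close> corrupted
  neighbours, so the subgraph of clean triples keeps the expansion \<open>n / 2 - 6 \<Delta>\<close> around a median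
  value \<open>\<alpha>\<close> of \<open>z - z\<^sup>*\<close>. Replacing a minimizer \<open>z\<close> on the clean triples by \<open>z\<^sup>* + \<alpha>\<close> removes at least
  \<open>w\<^sub>g (n / 2 - 6 \<Delta>) \<parallel>z - z\<^sup>* - \<alpha>\<parallel>\<close> from the clean rows and adds at most
  \<open>6 w\<^sub>b \<Delta> \<parallel>z - z\<^sup>* - \<alpha>\<parallel>\<close> on the corrupted ones, with the \<open>L\<^sup>1\<close> norm over clean triples.\<close>

subsection \<open>The Johnson graph\<close>

text \<open>These are the vertices of the Johnson graph. Between members of
  \<open>k_subsets V k\<close> the number \<open>card (s - t)\<close> is the graph distance, and
  \<open>card (s - t) = 1\<close> is adjacency.\<close>

definition k_subsets :: "'a set \<Rightarrow> nat \<Rightarrow> 'a set set" where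
  "k_subsets V k = {s. s \<subseteq> V \<and> card s = k}"

lemma finite_k_subsets: "finite V \<Longrightarrow> finite (k_subsets V k)"
  by (simp add: k_subsets_def)

lemma card_k_subsets: "finite V \<Longrightarrow> card (k_subsets V k) = card V choose k"
  by (simp add: k_subsets_def n_subsets)

lemma k_subsets_D:
  assumes "finite V" "s \<in> k_subsets V k"
  shows "s \<subseteq> V" "finite s" "card s = k"
  using assms by (auto simp: k_subsets_def intro: finite_subset)

lemma card_Diff_sym_k_subsets:
  assumes "finite V" "s \<in> k_subsets V k" "t \<in> k_subsets V k"
  shows "card (t - s) = card (s - t)"
  using assms card_le_sym_Diff[of s t] card_le_sym_Diff[of t s]
  by (metis k_subsets_D(2,3) le_antisym order_refl)

section \<open>Symmetry under permutations of the ground set\<close>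

lemma permutes_k_subsets_bij:
  assumes "p permutes V" "finite V"
  shows "bij_betw ((`) p) (k_subsets V k) (k_subsets V k)"
proof -
  have inj: "inj p" using assms(1) by (rule permutes_inj)
  have "inj_on ((`) p) (k_subsets V k)"
    using inj by (auto intro: inj_onI simp: inj_image_eq_iff)
  moreover have "((`) p) ` k_subsets V k \<subseteq> k_subsets V k"
    using permutes_image[OF assms(1)] inj
    by (auto simp: k_subsets_def card_image inj_on_subset)
  ultimately show ?thesis
    using finite_k_subsets[OF assms(2)] by (metis bij_betw_def endo_inj_surj)
qed

text \<open>Distance transitivity. A pair \<open>s\<close>, \<open>t\<close> cuts \<open>V\<close>
  into the cells \<open>s \<inter> t\<close>, \<open>s - t\<close>, \<open>t - s\<close> and the
  rest. Their sizes depend only on \<open>k\<close>, \<open>card V\<close> and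
  \<open>card (s - t)\<close>, so there are bijections between corresponding cells, and these glue
  to a permutation.\<close>

lemma permutes_pair_transitive:
  assumes V: "finite V"
    and s: "s \<in> k_subsets V k" and t: "t \<in> k_subsets V k"
    and s': "s' \<in> k_subsets V k" and t': "t' \<in> k_subsets V k"
    and d: "card (s - t) = card (s' - t')"
  obtains p where "p permutes V" "p ` s = s'" "p ` t = t'"
proof -
  note S = k_subsets_D[OF V s] and T = k_subsets_D[OF V t]
    and S' = k_subsets_D[OF V s'] and T' = k_subsets_D[OF V t']
  have c2: "card (t - s) = card (t' - s')"
    using d card_Diff_sym_k_subsets[OF V s t] card_Diff_sym_k_subsets[OF V s' t'] by simp
  have c1: "card (s \<inter> t) = card (s' \<inter> t')"
    using d card_Int_Diff[of s t] card_Int_Diff[of s' t'] S S' by simp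
  have "card (s \<union> t) = card (s' \<union> t')"
    using card_Un_Int[of s t] card_Un_Int[of s' t'] c1 S T S' T' by simp
  then have c3: "card (V - (s \<union> t)) = card (V - (s' \<union> t'))"
    using S T S' T' by (simp add: card_Diff_subset)
  obtain h1 where h1: "bij_betw h1 (s \<inter> t) (s' \<inter> t')"
    using finite_same_card_bij[OF _ _ c1] S S' by blast
  obtain h2 where h2: "bij_betw h2 (s - t) (s' - t')"
    using finite_same_card_bij[OF _ _ d] S S' by blast
  obtain h3 where h3: "bij_betw h3 (t - s) (t' - s')"
    using finite_same_card_bij[OF _ _ c2] T T' by blast
  obtain h4 where h4: "bij_betw h4 (V - (s \<union> t)) (V - (s' \<union> t'))"
    using finite_same_card_bij[OF _ _ c3] V by blast
  define p where "p = (\<lambda>y. if y \<in> s then (if y \<in> t then h1 y else h2 y)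
    else if y \<in> t then h3 y else if y \<in> V then h4 y else y)"
  have i1: "p ` (s \<inter> t) = s' \<inter> t'"
    using h1 by (auto simp: bij_betw_def p_def cong: image_cong_simp)
  have i2: "p ` (s - t) = s' - t'"
    using h2 by (auto simp: bij_betw_def p_def cong: image_cong_simp)
  have i3: "p ` (t - s) = t' - s'"
    using h3 by (auto simp: bij_betw_def p_def cong: image_cong_simp)
  have i4: "p ` (V - (s \<union> t)) = V - (s' \<union> t')"
    using h4 by (auto simp: bij_betw_def p_def cong: image_cong_simp)
  have ps: "p ` s = s'"
    using i1 i2 by (metis Int_Diff_Un image_Un)
  have pt: "p ` t = t'"
    using i1 i3 by (metis Int_Diff_Un Int_commute image_Un)
  have "V = (s \<union> t) \<union> (V - (s \<union> t))" using S T by auto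
  then have "p ` V = (s' \<union> t') \<union> (V - (s' \<union> t'))"
    using ps pt i4 by (metis image_Un)
  then have "p ` V = V" using S' T' by auto
  \<comment> \<open>A map of a finite set onto itself is injective, so knowing the images of the
    cells suffices.\<close>
  then have "bij_betw p V V"
    using V by (simp add: bij_betw_def eq_card_imp_inj_on)
  moreover have "p y = y" if "y \<notin> V" for y
    using that S T by (auto simp: p_def)
  ultimately have "p permutes V"
    by (simp add: bij_imp_permutes)
  then show thesis using ps pt that by blast
qed

section \<open>Degrees, total distances and averaged paths\<close>

lemma card_k_subsets_containing:
  assumes "finite V" "i \<in> V" "k \<ge> 1"
  shows "card {u \<in> k_subsets V k. i \<in> u} = (card V - 1) choose (k - 1)"
proof -
  have "{u \<in> k_subsets V k. i \<in> u} = k_subsets V k - k_subsets (V - {i}) k"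
    using assms by (auto simp: k_subsets_def)
  moreover have "k_subsets (V - {i}) k \<subseteq> k_subsets V k"
    by (auto simp: k_subsets_def)
  ultimately have "card {u \<in> k_subsets V k. i \<in> u} = (card V choose k) - ((card V - 1) choose k)"
    using assms by (simp add: card_Diff_subset finite_k_subsets card_k_subsets)
  moreover obtain m l where "card V = Suc m" "k = Suc l"
    using assms by (metis One_nat_def Suc_le_D card_gt_0_iff empty_iff gr0_implies_Suc)
  ultimately show ?thesis by simp
qed

text \<open>Double counting the pairs \<open>(i, u)\<close> with \<open>i\<close> in
  \<open>t \<inter> u\<close> gives the total size of the intersections, and
  \<open>card (t - u) = k - card (t \<inter> u)\<close> converts it. Divided out, the mean distance
  from \<open>t\<close> is \<open>k * (card V - k) / card V\<close>; the product form stays within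
  the naturals.\<close>

lemma sum_card_Diff_k_subsets:
  assumes V: "finite V" and t: "t \<in> k_subsets V k" and k: "k \<ge> 1"
  shows "card V * (\<Sum>u\<in>k_subsets V k. card (t - u)) = (card V choose k) * (k * (card V - k))"
proof -
  note T = k_subsets_D[OF V t]
  let ?K = "k_subsets V k"
  have "(\<Sum>u\<in>?K. card (t \<inter> u)) = (\<Sum>u\<in>?K. \<Sum>i\<in>t. if i \<in> u then 1 else 0)"
    using T by (simp add: sum.If_cases Int_def)
  also have "\<dots> = (\<Sum>i\<in>t. \<Sum>u\<in>?K. if i \<in> u then 1 else 0)"
    by (rule sum.swap)
  also have "\<dots> = (\<Sum>i\<in>t. card {u \<in> ?K. i \<in> u})"
    using finite_k_subsets[OF V] by (simp add: sum.If_cases Int_def)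
  also have "\<dots> = k * ((card V - 1) choose (k - 1))"
    using T k by (simp add: card_k_subsets_containing[OF V] subset_iff)
  finally have I: "(\<Sum>u\<in>?K. card (t \<inter> u)) = k * ((card V - 1) choose (k - 1))" .
  have "(\<Sum>u\<in>?K. card (t - u)) + (\<Sum>u\<in>?K. card (t \<inter> u)) = (\<Sum>u\<in>?K. card t)"
    unfolding sum.distrib[symmetric] using T
    by (intro sum.cong) (auto, metis add.commute card_Int_Diff)
  then have "(\<Sum>u\<in>?K. card (t - u)) + k * ((card V - 1) choose (k - 1)) = k * (card V choose k)"
    using T I card_k_subsets[OF V] by simp
  then have "card V * (\<Sum>u\<in>?K. card (t - u)) + k * (card V * ((card V - 1) choose (k - 1)))
      = k * (card V choose k) * card V"
    by (metis distrib_left mult.commute mult.left_commute)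
  \<comment> \<open>The absorption identity exposes \<open>k * (card V choose k)\<close> as a common
    factor of all remaining terms.\<close>
  moreover have "k * (card V choose k) = card V * ((card V - 1) choose (k - 1))"
    using k binomial_absorption[of "k - 1" "card V"] by simp
  ultimately have "card V * (\<Sum>u\<in>?K. card (t - u)) + k * (k * (card V choose k))
      = k * (card V choose k) * card V"
    by (simp only:)
  then show ?thesis
    by (simp add: diff_mult_distrib2 algebra_simps)
qed

text \<open>A neighbour exchanges one \<open>a\<close> in \<open>t\<close> for one \<open>b\<close>
  in \<open>V - t\<close>. The pair \<open>(a, b)\<close> is recovered from the two set differences
  with \<open>t\<close>, so each neighbour arises exactly once.\<close>

lemma card_k_subset_neighbours:
  assumes V: "finite V" and t: "t \<in> k_subsets V k"
  shows "card {u \<in> k_subsets V k. card (t - u) = 1} = k * (card V - k)"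
proof -
  note T = k_subsets_D[OF V t]
  let ?g = "\<lambda>(a, b). insert b (t - {a})"
  have "{u \<in> k_subsets V k. card (t - u) = 1} = ?g ` (t \<times> (V - t))" (is "?L = ?R")
  proof
    show "?L \<subseteq> ?R"
    proof
      fix u assume u: "u \<in> ?L"
      then have uK: "u \<in> k_subsets V k" and "card (t - u) = 1" "card (u - t) = 1"
        using card_Diff_sym_k_subsets[OF V t, of u] by auto
      then obtain a b where "t - u = {a}" "u - t = {b}"
        by (meson card_1_singletonE)
      then have "u = ?g (a, b)" "(a, b) \<in> t \<times> (V - t)"
        using k_subsets_D[OF V uK] by auto
      then show "u \<in> ?R" by blast
    qed
    show "?R \<subseteq> ?L"
    proof clarify
      fix a b assume ab: "a \<in> t" "b \<in> V" "b \<notin> t"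
      then have "card (insert b (t - {a})) = k"
        using T by (metis Diff_iff card.insert card_Suc_Diff1 finite_Diff)
      moreover have "t - insert b (t - {a}) = {a}" using ab by auto
      ultimately show "insert b (t - {a}) \<in> k_subsets V k \<and> card (t - insert b (t - {a})) = 1"
        using ab T by (auto simp: k_subsets_def)
    qed
  qed
  moreover have "inj_on ?g (t \<times> (V - t))"
  proof (rule inj_onI, clarify)
    fix a b a' b'
    assume ab: "a \<in> t" "b \<in> V" "b \<notin> t" "a' \<in> t" "b' \<in> V" "b' \<notin> t"
      and eq: "insert b (t - {a}) = insert b' (t - {a'})"
    have "t - insert b (t - {a}) = {a}" "t - insert b' (t - {a'}) = {a'}"
      "insert b (t - {a}) - t = {b}" "insert b' (t - {a'}) - t = {b'}" using ab by auto
    then show "a = a' \<and> b = b'" using eq by auto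
  qed
  ultimately show ?thesis
    using T V by (simp add: card_image card_Diff_subset)
qed

text \<open>Exchange the elements of \<open>s - t\<close> for those of \<open>t - s\<close> one at a
  time. The triangle inequality applies along this path, and each of its \<open>card (s - t)\<close>
  steps, summed over all permutations, costs the same \<open>c\<close>.\<close>

lemma sum_permutes_path_bound:
  fixes f :: "'a set \<Rightarrow> real"
  assumes V: "finite V"
    and c: "\<And>s t. s \<in> k_subsets V k \<Longrightarrow> t \<in> k_subsets V k \<Longrightarrow> card (s - t) = 1 \<Longrightarrow>
      (\<Sum>p | p permutes V. \<bar>f (p ` s) - f (p ` t)\<bar>) = c"
    and s: "s \<in> k_subsets V k" and t: "t \<in> k_subsets V k"
  shows "(\<Sum>p | p permutes V. \<bar>f (p ` s) - f (p ` t)\<bar>) \<le> real (card (s - t)) * c"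
  using s
proof (induction "card (s - t)" arbitrary: s)
  case 0
  note S = k_subsets_D[OF V 0(2)] and T = k_subsets_D[OF V t]
  have "s = t" using 0 S T by (simp add: card_subset_eq)
  then show ?case by simp
next
  case (Suc m)
  note S = k_subsets_D[OF V Suc.prems] and T = k_subsets_D[OF V t]
  have "card (t - s) = Suc m"
    using Suc card_Diff_sym_k_subsets[OF V Suc.prems t] by simp
  then obtain a b where a: "a \<in> s - t" and b: "b \<in> t - s"
    using Suc.hyps(2) by (metis card.empty ex_in_conv nat.distinct(1))
  \<comment> \<open>The next vertex after \<open>s\<close> on a shortest path to
    \<open>t\<close>.\<close>
  define s' where "s' = insert b (s - {a})"
  have "card s' = k"
    using a b S unfolding s'_def by (metis Diff_iff card.insert card_Suc_Diff1 finite_Diff)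
  then have s': "s' \<in> k_subsets V k"
    using a b S T by (auto simp: k_subsets_def s'_def)
  have "s - s' = {a}" using a b by (auto simp: s'_def)
  then have step: "(\<Sum>p | p permutes V. \<bar>f (p ` s) - f (p ` s')\<bar>) = c"
    using c[OF Suc.prems s'] by simp
  have "s' - t = (s - t) - {a}" using a b by (auto simp: s'_def)
  then have m: "m = card (s' - t)" using Suc.hyps(2) a S by simp
  have "(\<Sum>p | p permutes V. \<bar>f (p ` s) - f (p ` t)\<bar>)
    \<le> (\<Sum>p | p permutes V. \<bar>f (p ` s) - f (p ` s')\<bar> + \<bar>f (p ` s') - f (p ` t)\<bar>)"
    by (intro sum_mono) linarith
  also have "\<dots> \<le> c + real m * c"
    using step Suc.hyps(1)[OF m s'] m by (simp add: sum.distrib)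
  finally show ?case using Suc.hyps(2)[symmetric] by (simp add: algebra_simps)
qed

text \<open>The constant \<open>card V\<close> is the degree \<open>k * (card V - k)\<close> divided
  by the mean distance \<open>k * (card V - k) / card V\<close>, when these are nonzero. Both sums
  run over ordered pairs.\<close>

lemma johnson_graph_poincare_L1:
  fixes f :: "'a set \<Rightarrow> real"
  assumes V: "finite V" and k: "k \<ge> 1"
  defines "K \<equiv> k_subsets V k"
  shows "real (card V) * (\<Sum>(s, t)\<in>K \<times> K. \<bar>f s - f t\<bar>)
    \<le> real (card K) * (\<Sum>(s, t) | s \<in> K \<and> t \<in> K \<and> card (s - t) = 1. \<bar>f s - f t\<bar>)"
proof -
  let ?P = "{p. p permutes V}"
  let ?A = "{(s, t). s \<in> K \<and> t \<in> K \<and> card (s - t) = 1}"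
  let ?g = "\<lambda>s t. \<Sum>p\<in>?P. \<bar>f (p ` s) - f (p ` t)\<bar>"
  have fK: "finite K" unfolding K_def using V by (rule finite_k_subsets)
  have fA: "finite ?A" by (rule finite_subset[of _ "K \<times> K"]) (use fK in auto)
  have P0: "card ?P > 0" using V permutes_id finite_permutations card_gt_0_iff by blast
  \<comment> \<open>By distance transitivity some \<open>q\<close> carries any adjacent pair to any
    other, and composing with \<open>q\<close> only reorders the permutations. Without adjacent
    pairs the claim is vacuous.\<close>
  have "\<exists>c. \<forall>s t. s \<in> K \<longrightarrow> t \<in> K \<longrightarrow> card (s - t) = 1 \<longrightarrow> ?g s t = c"
  proof (cases "?A = {}")
    case False
    then obtain s0 t0 where st0: "s0 \<in> K" "t0 \<in> K" "card (s0 - t0) = 1" by auto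
    have "?g s t = ?g s0 t0" if st: "s \<in> K" "t \<in> K" "card (s - t) = 1" for s t
    proof -
      obtain q where q: "q permutes V" "q ` s0 = s" "q ` t0 = t"
        using permutes_pair_transitive[OF V, of s0 k t0 s t] st st0 unfolding K_def by metis
      show ?thesis
        unfolding sum_permutations_compose_right[OF q(1), of "\<lambda>p. \<bar>f (p ` s0) - f (p ` t0)\<bar>"]
        by (simp only: image_comp[symmetric] q)
    qed
    then show ?thesis by blast
  qed blast
  then obtain c where c: "\<And>s t. s \<in> K \<Longrightarrow> t \<in> K \<Longrightarrow> card (s - t) = 1 \<Longrightarrow> ?g s t = c"
    by blast
  have bij: "bij_betw (map_prod ((`) p) ((`) p)) (K \<times> K) (K \<times> K)" if "p permutes V" for p
    unfolding K_def using permutes_k_subsets_bij[OF that V] by (intro bij_betw_map_prod)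
  have adj: "card (p ` s - p ` t) = card (s - t)" if "p permutes V" for p s t
    using permutes_inj[OF that] by (metis card_image image_set_diff inj_on_subset subset_UNIV)
  have all: "(\<Sum>(s, t)\<in>K \<times> K. \<bar>f (p ` s) - f (p ` t)\<bar>) = (\<Sum>(s, t)\<in>K \<times> K. \<bar>f s - f t\<bar>)"
    if "p permutes V" for p
    using sum.reindex_bij_betw[OF bij[OF that], of "\<lambda>(s, t). \<bar>f s - f t\<bar>"]
    by (simp add: case_prod_unfold)
  have "bij_betw (map_prod ((`) p) ((`) p)) ?A ?A" if p: "p permutes V" for p
  proof -
    have "inj_on (map_prod ((`) p) ((`) p)) ?A"
      using bij[OF p] by (auto simp: bij_betw_def intro: inj_on_subset)
    moreover have "map_prod ((`) p) ((`) p) ` ?A \<subseteq> ?A"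
      using permutes_k_subsets_bij[OF p V, of k] adj[OF p] unfolding K_def bij_betw_def by auto
    ultimately show ?thesis using fA by (metis (lifting) bij_betw_def endo_inj_surj)
  qed
  then have nbr: "(\<Sum>(s, t)\<in>?A. \<bar>f (p ` s) - f (p ` t)\<bar>) = (\<Sum>(s, t)\<in>?A. \<bar>f s - f t\<bar>)"
    if "p permutes V" for p
    using sum.reindex_bij_betw[of "map_prod ((`) p) ((`) p)" ?A ?A "\<lambda>(s, t). \<bar>f s - f t\<bar>"] that
    by (simp add: case_prod_unfold)
  \<comment> \<open>Each permutation only rearranges the pairs, so summing over \<open>?P\<close>
    multiplies by \<open>card ?P\<close>. Exchanging the sums brings in the path bound.\<close>
  have "real (card ?P) * (\<Sum>(s, t)\<in>K \<times> K. \<bar>f s - f t\<bar>)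
    = (\<Sum>p\<in>?P. \<Sum>(s, t)\<in>K \<times> K. \<bar>f (p ` s) - f (p ` t)\<bar>)"
    using all by simp
  also have "\<dots> = (\<Sum>(s, t)\<in>K \<times> K. ?g s t)"
    by (simp add: case_prod_unfold) (rule sum.swap)
  also have "\<dots> \<le> (\<Sum>(s, t)\<in>K \<times> K. real (card (s - t)) * c)"
    by (intro sum_mono, clarify, rule sum_permutes_path_bound[OF V, where k=k])
       (use c in \<open>auto simp: K_def\<close>)
  also have "\<dots> = real (\<Sum>s\<in>K. \<Sum>t\<in>K. card (s - t)) * c"
    by (simp add: sum.cartesian_product sum_distrib_right case_prod_unfold)
  finally have upper: "real (card ?P) * (\<Sum>(s, t)\<in>K \<times> K. \<bar>f s - f t\<bar>)
    \<le> real (\<Sum>s\<in>K. \<Sum>t\<in>K. card (s - t)) * c" .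
  have "real (card ?P) * (\<Sum>(s, t)\<in>?A. \<bar>f s - f t\<bar>)
    = (\<Sum>p\<in>?P. \<Sum>(s, t)\<in>?A. \<bar>f (p ` s) - f (p ` t)\<bar>)"
    using nbr by simp
  also have "\<dots> = (\<Sum>(s, t)\<in>?A. ?g s t)"
    by (simp add: case_prod_unfold) (rule sum.swap)
  also have "\<dots> = (\<Sum>(s, t)\<in>?A. c)"
    using c by (intro sum.cong) auto
  also have "\<dots> = real (card ?A) * c"
    by (simp add: case_prod_unfold)
  finally have exact: "real (card ?P) * (\<Sum>(s, t)\<in>?A. \<bar>f s - f t\<bar>) = real (card ?A) * c" .
  have "?A = (SIGMA s:K. {t \<in> K. card (s - t) = 1})" by auto
  then have cA: "card ?A = card K * (k * (card V - k))"
    using fK by (simp add: K_def card_k_subset_neighbours[OF V] del: One_nat_def)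
  \<comment> \<open>Total distance and number of adjacent pairs stand in the ratio
    \<open>card K\<close> to \<open>card V\<close>, so \<open>c\<close> can be eliminated between
    \<open>upper\<close> and \<open>exact\<close>.\<close>
  have cD: "card V * (\<Sum>s\<in>K. \<Sum>t\<in>K. card (s - t)) = card K * card ?A"
    unfolding sum_distrib_left cA
    by (simp add: K_def sum_distrib_left[symmetric] sum_card_Diff_k_subsets[OF V _ k] card_k_subsets[OF V])
  have "real (card ?P) * (real (card V) * (\<Sum>(s, t)\<in>K \<times> K. \<bar>f s - f t\<bar>))
    \<le> real (card V) * (real (\<Sum>s\<in>K. \<Sum>t\<in>K. card (s - t)) * c)"
    using mult_left_mono[OF upper, of "real (card V)"] by (simp add: mult.left_commute)
  also have "\<dots> = real (card K) * (real (card ?A) * c)"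
    using arg_cong[OF cD, of real] by (simp add: mult.assoc[symmetric] del: of_nat_sum)
  also have "\<dots> = real (card ?P) * (real (card K) * (\<Sum>(s, t)\<in>?A. \<bar>f s - f t\<bar>))"
    using exact by (simp add: mult.left_commute)
  finally show ?thesis using P0 by (simp add: mult_le_cancel_left)
qed

subsection \<open>Expansion of the graph of clean triples\<close>

text \<open>Center \<open>v\<close> at a median over \<open>T0\<close> and extend it by 0 to
  \<open>T\<close>. Each vertex of \<open>T\<close>, inside or outside \<open>T0\<close>, then has
  total difference to \<open>T0\<close> at least the centered norm \<open>M\<close>, so the Poincare
  inequality bounds the full edge sum below by \<open>m * M\<close>. Edges within
  \<open>T - T0\<close> contribute 0, and crossing edges at most \<open>D * M\<close> in each
  direction, which explains \<open>2 * D\<close>.\<close>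

lemma poincare_L1_vertex_deletion:
  fixes v :: "'a \<Rightarrow> real" and m D :: real
  assumes T: "finite T" and T0: "T0 \<subseteq> T" "T0 \<noteq> {}"
    and sym: "\<And>t u. adj t u \<Longrightarrow> adj u t"
    and poincare: "\<And>g :: 'a \<Rightarrow> real. m * (\<Sum>(t, u)\<in>T \<times> T. \<bar>g t - g u\<bar>)
      \<le> real (card T) * (\<Sum>(t, u) | t \<in> T \<and> u \<in> T \<and> adj t u. \<bar>g t - g u\<bar>)"
    and m: "m \<ge> 0"
    and D: "\<And>t. t \<in> T0 \<Longrightarrow> real (card {u \<in> T - T0. adj t u}) \<le> D"
  obtains \<alpha> where "(m - 2 * D) * (\<Sum>t\<in>T0. \<bar>v t - \<alpha>\<bar>)
    \<le> (\<Sum>(t, u) | t \<in> T0 \<and> u \<in> T0 \<and> adj t u. \<bar>v t - v u\<bar>)"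
proof -
  have fT0: "finite T0" using T T0 finite_subset by blast
  \<comment> \<open>Such a \<open>v t0\<close> is a median of \<open>v\<close>; its optimality among the values of \<open>v\<close> suffices below.\<close>
  obtain t0 where "is_arg_min (\<lambda>t. \<Sum>u\<in>T0. \<bar>v u - v t\<bar>) (\<lambda>t. t \<in> T0) t0"
    using ex_is_arg_min_if_finite[OF fT0 T0(2)] by blast
  then have t0: "(\<Sum>u\<in>T0. \<bar>v u - v t0\<bar>) \<le> (\<Sum>u\<in>T0. \<bar>v u - v t\<bar>)" if "t \<in> T0" for t
    using that by (auto simp: is_arg_min_def not_less)
  define g where "g t = (if t \<in> T0 then v t - v t0 else 0)" for t
  define M where "M = (\<Sum>t\<in>T0. \<bar>v t - v t0\<bar>)"
  let ?E = "\<lambda>A B. {(t, u). t \<in> A \<and> u \<in> B \<and> adj t u}"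
  let ?s = "\<lambda>S. \<Sum>(t, u)\<in>S. \<bar>g t - g u\<bar>"
  have fE: "finite (?E A B)" if "A \<subseteq> T" "B \<subseteq> T" for A B
    by (rule finite_subset[of _ "T \<times> T"]) (use that T in auto)
  have "M \<le> (\<Sum>u\<in>T. \<bar>g t - g u\<bar>)" if "t \<in> T" for t
  proof -
    have "M \<le> (\<Sum>u\<in>T0. \<bar>g t - g u\<bar>)"
    proof (cases "t \<in> T0")
      case True
      then have "(\<Sum>u\<in>T0. \<bar>g t - g u\<bar>) = (\<Sum>u\<in>T0. \<bar>v u - v t\<bar>)"
        by (intro sum.cong) (auto simp: g_def)
      then show ?thesis using t0[OF True] by (simp add: M_def)
    next
      case False
      then show ?thesis by (simp add: g_def M_def abs_minus_commute)
    qed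
    also have "\<dots> \<le> (\<Sum>u\<in>T. \<bar>g t - g u\<bar>)"
      by (rule sum_mono2) (use T T0 in auto)
    finally show ?thesis .
  qed
  then have "real (card T) * M \<le> (\<Sum>t\<in>T. \<Sum>u\<in>T. \<bar>g t - g u\<bar>)"
    by (simp add: sum_bounded_below)
  then have "m * (real (card T) * M) \<le> m * (\<Sum>(t, u)\<in>T \<times> T. \<bar>g t - g u\<bar>)"
    using m by (simp add: sum.cartesian_product mult_left_mono)
  then have "real (card T) * (m * M) \<le> real (card T) * ?s (?E T T)"
    using poincare[of g] by (simp add: mult.left_commute)
  moreover have "card T > 0" using T T0 by (auto simp: card_gt_0_iff)
  ultimately have lower: "m * M \<le> ?s (?E T T)"
    by (simp add: mult_le_cancel_left)
  have splitl: "?s (?E (A \<union> B) S) = ?s (?E A S) + ?s (?E B S)"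
    if "A \<inter> B = {}" "A \<subseteq> T" "B \<subseteq> T" "S \<subseteq> T" for A B S
  proof -
    have "?E (A \<union> B) S = ?E A S \<union> ?E B S" "?E A S \<inter> ?E B S = {}" using that by auto
    then show ?thesis using fE that by (simp only: sum.union_disjoint)
  qed
  have splitr: "?s (?E S (A \<union> B)) = ?s (?E S A) + ?s (?E S B)"
    if "A \<inter> B = {}" "A \<subseteq> T" "B \<subseteq> T" "S \<subseteq> T" for A B S
  proof -
    have "?E S (A \<union> B) = ?E S A \<union> ?E S B" "?E S A \<inter> ?E S B = {}" using that by auto
    then show ?thesis using fE that by (simp only: sum.union_disjoint)
  qed
  have T_eq: "T = T0 \<union> (T - T0)" and disj: "T0 \<inter> (T - T0) = {}" using T0 by auto
  have "?s (?E T T) = ?s (?E T0 T) + ?s (?E (T - T0) T)"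
    using splitl[OF disj T0(1) Diff_subset order_refl] by (simp only: T_eq[symmetric])
  also have "\<dots> = (?s (?E T0 T0) + ?s (?E T0 (T - T0)))
      + (?s (?E (T - T0) T0) + ?s (?E (T - T0) (T - T0)))"
    using splitr[OF disj T0(1) Diff_subset T0(1)]
      splitr[OF disj T0(1) Diff_subset Diff_subset] by (simp only: T_eq[symmetric])
  finally have split: "?s (?E T T) = \<dots>" .
  have "?s (?E (T - T0) (T - T0)) = 0"
    by (rule sum.neutral) (auto simp: g_def)
  moreover have "?s (?E (T - T0) T0) = ?s (?E T0 (T - T0))"
    by (rule sum.reindex_bij_witness[of _ prod.swap prod.swap])
       (auto intro: sym simp: abs_minus_commute)
  moreover have "?s (?E T0 (T - T0)) \<le> D * M"
  proof -
    have "?E T0 (T - T0) = (SIGMA t:T0. {u \<in> T - T0. adj t u})" by auto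
    then have "?s (?E T0 (T - T0)) = (\<Sum>t\<in>T0. \<Sum>u\<in>{u \<in> T - T0. adj t u}. \<bar>g t - g u\<bar>)"
      using fT0 T by (simp add: sum.Sigma)
    also have "\<dots> = (\<Sum>t\<in>T0. real (card {u \<in> T - T0. adj t u}) * \<bar>v t - v t0\<bar>)"
      by (rule sum.cong) (auto simp: g_def)
    also have "\<dots> \<le> (\<Sum>t\<in>T0. D * \<bar>v t - v t0\<bar>)"
      by (intro sum_mono mult_right_mono D) auto
    finally show ?thesis by (simp add: M_def sum_distrib_left)
  qed
  moreover have "?s (?E T0 T0) = (\<Sum>(t, u)\<in>?E T0 T0. \<bar>v t - v u\<bar>)"
    by (rule sum.cong) (auto simp: g_def)
  ultimately have "(m - 2 * D) * M \<le> (\<Sum>(t, u)\<in>?E T0 T0. \<bar>v t - v u\<bar>)"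
    using lower split by (simp add: algebra_simps)
  then show thesis using that by (simp add: M_def)
qed

section \<open>Camera triples as three-element sets\<close>

fun cameras :: "triple \<Rightarrow> nat set" where
  "cameras (i, j, k) = {i, j, k}"

lemma tri_edges_conv_cameras:
  "t \<in> triples n \<Longrightarrow> tri_edges t = {(a, b). a \<in> cameras t \<and> b \<in> cameras t \<and> a < b}"
  by (cases t) (auto simp: triples_def)

lemma card_cameras: "t \<in> triples n \<Longrightarrow> card (cameras t) = 3"
  by (cases t) (auto simp: triples_def)

lemma finite_cameras: "finite (cameras t)"
  by (cases t) auto

text \<open>The entries of a triple increase, so sorting its camera set recovers it.\<close>

lemma inj_on_cameras: "inj_on cameras (triples n)"
proof (rule inj_onI)
  fix t u
  assume tu: "t \<in> triples n" "u \<in> triples n" "cameras t = cameras u"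
  obtain i j k where t: "t = (i, j, k)" by (cases t)
  obtain i' j' k' where u: "u = (i', j', k')" by (cases u)
  have "sorted_list_of_set {i, j, k} = sorted_list_of_set {i', j', k'}"
    using tu t u by simp
  then show "t = u"
    using tu(1,2) by (auto simp: t u triples_def)
qed

lemma cameras_bij: "bij_betw cameras (triples n) (k_subsets {1..n} 3)"
proof -
  have "s \<in> cameras ` triples n" if s: "s \<in> k_subsets {1..n} 3" for s
  proof -
    have fs: "finite s" and V: "s \<subseteq> {1..n}" and c: "card s = 3"
      using k_subsets_D[OF _ s] by auto
    obtain i j k where l: "sorted_list_of_set s = [i, j, k]"
      using fs c length_sorted_list_of_set[of s]
      by (auto simp: numeral_3_eq_3 length_Suc_conv simp del: length_sorted_list_of_set)
    have "s = {i, j, k}"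
      using set_sorted_list_of_set[OF fs] l by simp
    moreover have "i < j" "j < k"
      using strict_sorted_list_of_set[of s] l by auto
    ultimately have "s = cameras (i, j, k)" "(i, j, k) \<in> triples n"
      using V by (auto simp: triples_def)
    then show ?thesis by blast
  qed
  moreover have "cameras t \<in> k_subsets {1..n} 3" if "t \<in> triples n" for t
    using that card_cameras[OF that] by (cases t) (auto simp: k_subsets_def triples_def)
  ultimately show ?thesis using inj_on_cameras by (auto simp: bij_betw_def)
qed

lemma finite_triples: "finite (triples n)"
  using cameras_bij finite_k_subsets by (metis bij_betw_finite finite_atLeastAtMost)

lemma tri_edges_Int:
  assumes "t \<in> triples n" "u \<in> triples n"
  shows "tri_edges t \<inter> tri_edges u = {(a, b). {a, b} \<subseteq> cameras t \<inter> cameras u \<and> a < b}"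
  using assms by (auto simp: tri_edges_conv_cameras)

text \<open>Sharing an edge means sharing at least two of the three cameras, and distinctness
  excludes sharing all three.\<close>

lemma adjacent_iff_card_Diff:
  assumes t: "t \<in> triples n" and u: "u \<in> triples n"
  shows "adjacent t u \<longleftrightarrow> card (cameras t - cameras u) = 1"
proof -
  let ?I = "cameras t \<inter> cameras u"
  have c: "card ?I + card (cameras t - cameras u) = 3"
    using card_Int_Diff[of "cameras t" "cameras u"] t by (simp add: card_cameras finite_cameras)
  have fI: "finite ?I" by (simp add: finite_cameras)
  have e: "t = u \<longleftrightarrow> card (cameras t - cameras u) = 0"
  proof
    assume "card (cameras t - cameras u) = 0"
    then have "cameras t = cameras u"
      using t u by (simp add: finite_cameras card_cameras card_subset_eq)
    then show "t = u" using inj_on_cameras t u by (auto dest: inj_onD)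
  qed simp
  have i: "tri_edges t \<inter> tri_edges u \<noteq> {} \<longleftrightarrow> card ?I \<ge> 2"
  proof
    assume "tri_edges t \<inter> tri_edges u \<noteq> {}"
    then obtain a b where ab: "{a, b} \<subseteq> ?I" "a < b" unfolding tri_edges_Int[OF t u] by auto
    then show "card ?I \<ge> 2" using card_mono[OF fI ab(1)] by simp
  next
    assume "card ?I \<ge> 2"
    then obtain S where "S \<subseteq> ?I" "card S = 2" by (meson obtain_subset_with_card_n)
    then obtain a b where "{a, b} \<subseteq> ?I" "a \<noteq> b" by (auto simp: card_2_iff)
    then have "(a, b) \<in> tri_edges t \<inter> tri_edges u \<or> (b, a) \<in> tri_edges t \<inter> tri_edges u"
      unfolding tri_edges_Int[OF t u] by auto
    then show "tri_edges t \<inter> tri_edges u \<noteq> {}" by auto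
  qed
  show ?thesis unfolding adjacent_def e i using c by linarith
qed

lemma adjacent_sym: "adjacent t u \<Longrightarrow> adjacent u t"
  by (auto simp: adjacent_def)

text \<open>The Johnson inequality for \<open>k = 3\<close> and \<open>V = {1..n}\<close>, carried
  over along the bijection \<open>cameras\<close>.\<close>

lemma triples_poincare_L1:
  fixes g :: "triple \<Rightarrow> real"
  shows "real n * (\<Sum>(t, u)\<in>triples n \<times> triples n. \<bar>g t - g u\<bar>)
    \<le> real (card (triples n)) *
      (\<Sum>(t, u) | t \<in> triples n \<and> u \<in> triples n \<and> adjacent t u. \<bar>g t - g u\<bar>)"
proof -
  let ?T = "triples n" and ?K = "k_subsets {1..n} 3"
  let ?A = "{(t, u). t \<in> ?T \<and> u \<in> ?T \<and> adjacent t u}"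
  let ?B = "{(s, t). s \<in> ?K \<and> t \<in> ?K \<and> card (s - t) = 1}"
  define f where "f s = g (inv_into ?T cameras s)" for s
  have f: "f (cameras t) = g t" if "t \<in> ?T" for t
    using that inj_on_cameras by (simp add: f_def)
  let ?c = "map_prod cameras cameras"
  have b: "bij_betw ?c (?T \<times> ?T) (?K \<times> ?K)"
    using cameras_bij by (intro bij_betw_map_prod)
  have "?c ` ?A = ?B"
  proof
    show "?c ` ?A \<subseteq> ?B"
    proof (rule image_subsetI)
      fix q assume "q \<in> ?A"
      then obtain t u where q: "q = (t, u)" and tu: "t \<in> ?T" "u \<in> ?T" "adjacent t u" by auto
      then show "?c q \<in> ?B"
        using bij_betwE[OF cameras_bij] adjacent_iff_card_Diff[OF tu(1,2)] by simp
    qed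
    show "?B \<subseteq> ?c ` ?A"
    proof clarify
      fix s s' assume s: "s \<in> ?K" "s' \<in> ?K" "card (s - s') = 1"
      then obtain t u where "t \<in> ?T" "u \<in> ?T" "s = cameras t" "s' = cameras u"
        using cameras_bij by (metis bij_betw_imp_surj_on imageE)
      then show "(s, s') \<in> ?c ` ?A"
        using s adjacent_iff_card_Diff[of t n u] by (auto intro!: image_eqI[of _ _ "(t, u)"])
    qed
  qed
  moreover have "inj_on ?c ?A"
    using b by (auto simp: bij_betw_def intro: inj_on_subset)
  ultimately have bA: "bij_betw ?c ?A ?B" by (simp add: bij_betw_def)
  have "(\<Sum>(s, t)\<in>?K \<times> ?K. \<bar>f s - f t\<bar>) = (\<Sum>(t, u)\<in>?T \<times> ?T. \<bar>g t - g u\<bar>)"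
    unfolding sum.reindex_bij_betw[OF b, symmetric]
    by (rule sum.cong) (simp_all add: case_prod_unfold mem_Times_iff f)
  moreover have "(\<Sum>(s, t)\<in>?B. \<bar>f s - f t\<bar>) = (\<Sum>(t, u)\<in>?A. \<bar>g t - g u\<bar>)"
    unfolding sum.reindex_bij_betw[OF bA, symmetric]
    by (rule sum.cong) (simp_all add: case_prod_unfold mem_Times_iff f)
  ultimately show ?thesis
    using johnson_graph_poincare_L1[of "{1..n}" 3 f] bij_betw_same_card[OF cameras_bij]
    by simp
qed

text \<open>Adjacent triples have exactly two common cameras, hence one common increasing pair, so
  the definite description denotes it.\<close>

lemma shared_edge_in:
  assumes t: "t \<in> triples n" and u: "u \<in> triples n" and adj: "adjacent t u"
  shows "shared_edge t u \<in> tri_edges t \<inter> tri_edges u"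
proof -
  let ?I = "cameras t \<inter> cameras u"
  have c: "card ?I = 2"
    using card_Int_Diff[of "cameras t" "cameras u"] adj
    by (simp add: card_cameras[OF t] finite_cameras adjacent_iff_card_Diff[OF t u])
  then obtain a b where I: "?I = {a, b}" and "a \<noteq> b" by (auto simp: card_2_iff)
  then have "tri_edges t \<inter> tri_edges u = {(min a b, max a b)}"
    unfolding tri_edges_Int[OF t u] I by (auto simp: min_def max_def)
  then have "\<exists>!e. e \<in> tri_edges t \<inter> tri_edges u" by simp
  then show ?thesis unfolding shared_edge_def by (rule theI')
qed

lemma edge_degree_le_max_degree: "i \<in> {1..n} \<Longrightarrow> edge_degree E i \<le> max_degree n E"
  by (simp add: max_degree_def)

text \<open>The factor 6 counts the pairs \<open>(p, e)\<close> of an edge \<open>e\<close> of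
  \<open>t\<close> and an endpoint \<open>p\<close> of \<open>e\<close>. Each pair accounts for at
  most one neighbour per corrupted edge at \<open>p\<close>.\<close>

lemma card_corrupted_neighbours:
  assumes part: "E0 \<union> Eb = complete_edges n"
    and t: "t \<in> triples n" "clean E0 t"
  shows "card {u \<in> triples n. \<not> clean E0 u \<and> adjacent t u} \<le> 6 * max_degree n Eb"
proof -
  let ?W = "{u \<in> triples n. \<not> clean E0 u \<and> adjacent t u}"
  let ?G = "\<lambda>p. {g \<in> Eb. fst g = p \<or> snd g = p}"
  let ?S = "\<lambda>(p, e). (\<lambda>g. {fst e, snd e, fst g, snd g}) ` ?G p"
  let ?X = "{(p, e). e \<in> tri_edges t \<and> (p = fst e \<or> p = snd e)}"
  have "complete_edges n \<subseteq> {1..n} \<times> {1..n}"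
    by (auto simp: complete_edges_def)
  moreover have "Eb \<subseteq> complete_edges n" using part by blast
  ultimately have fEb: "finite Eb" by (meson finite_SigmaI finite_atLeastAtMost finite_subset)
  obtain i j k where t_eq: "t = (i, j, k)" by (cases t)
  have X: "?X = {(i, (i, j)), (j, (i, j)), (j, (j, k)), (k, (j, k)), (i, (i, k)), (k, (i, k))}"
    unfolding t_eq by auto
  have fX: "finite ?X" unfolding X by simp
  have "card ?X = 6" unfolding X using t(1) by (auto simp: t_eq triples_def)
  \<comment> \<open>A corrupted neighbour is the union of the shared clean edge \<open>e\<close> and a corrupted edge at an
    endpoint \<open>p\<close> of \<open>e\<close>.\<close>
  have "cameras ` ?W \<subseteq> (\<Union>q\<in>?X. ?S q)"
  proof clarify
    fix u1 u2 u3 assume u: "(u1, u2, u3) \<in> triples n" "\<not> clean E0 (u1, u2, u3)" "adjacent t (u1, u2, u3)"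
    define u where "u = (u1, u2, u3)"
    note u = u[folded u_def]
    obtain e where e: "e \<in> tri_edges t" "e \<in> tri_edges u"
      using u(3) by (auto simp: adjacent_def)
    obtain g where g: "g \<in> tri_edges u" "g \<notin> E0"
      using u(2) by (auto simp: clean_def)
    have "g \<in> complete_edges n"
      using g u(1) by (auto simp: u_def triples_def complete_edges_def)
    then have gb: "g \<in> Eb" using part g by blast
    \<comment> \<open>One edge is clean and the other is not. Two distinct edges of a triple cover
      its cameras and meet in a camera, which becomes \<open>p\<close>.\<close>
    have ne: "e \<noteq> g" using e(1) g(2) t(2) by (auto simp: clean_def)
    have eg: "(e, g) \<in> {((u1, u2), (u2, u3)), ((u1, u2), (u1, u3)), ((u2, u3), (u1, u2)),
        ((u2, u3), (u1, u3)), ((u1, u3), (u1, u2)), ((u1, u3), (u2, u3))}"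
      using e(2) g(1) ne by (auto simp: u_def)
    then have "cameras u = {fst e, snd e, fst g, snd g}"
      unfolding u_def cameras.simps by (elim insertE emptyE) (simp_all add: insert_commute)
    moreover have "fst g = fst e \<or> fst g = snd e \<or> snd g = fst e \<or> snd g = snd e"
      using eg by auto
    then obtain p where "p = fst e \<or> p = snd e" "fst g = p \<or> snd g = p" by blast
    ultimately have "cameras u \<in> ?S (p, e)" "(p, e) \<in> ?X"
      unfolding prod.case using e(1) gb by (auto intro!: image_eqI[of _ _ g] simp del: cameras.simps)
    then show "cameras (u1, u2, u3) \<in> (\<Union>q\<in>?X. ?S q)"
      unfolding u_def[symmetric] by (rule UN_I[rotated])
  qed
  moreover have "finite (\<Union>q\<in>?X. ?S q)"
    using fX fEb by auto
  ultimately have "card (cameras ` ?W) \<le> card (\<Union>q\<in>?X. ?S q)"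
    by (meson card_mono)
  also have "\<dots> \<le> (\<Sum>q\<in>?X. card (?S q))"
    by (rule card_UN_le[OF fX])
  also have "\<dots> \<le> (\<Sum>q\<in>?X. max_degree n Eb)"
  proof (rule sum_mono)
    fix q assume "q \<in> ?X"
    then have p: "fst q \<in> {1..n}" unfolding X using t(1) by (auto simp: t_eq triples_def)
    have "card (?S q) \<le> card (?G (fst q))"
      using fEb by (simp add: case_prod_unfold card_image_le)
    also have "\<dots> \<le> max_degree n Eb"
      using edge_degree_le_max_degree[OF p] by (simp add: edge_degree_def)
    finally show "card (?S q) \<le> max_degree n Eb" .
  qed
  also have "\<dots> = 6 * max_degree n Eb"
    using \<open>card ?X = 6\<close> by simp
  \<comment> \<open>Counting camera sets counts the triples themselves, by injectivity.\<close>
  finally show ?thesis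
    by (subst (asm) card_image) (auto intro: inj_on_subset[OF inj_on_cameras])
qed

subsection \<open>Recovery\<close>

text \<open>In a clean triple the height at an edge is the sine of the opposite angle, so the scale
  is the diameter of the circumscribed circle. Uniqueness follows by cancelling a positive
  height.\<close>

lemma true_scale:
  assumes x: "inj_on x {1..n}"
    and t: "t \<in> triples n" "tri_edges t \<subseteq> E0" "nondegenerate d t"
    and antisym: "\<And>i j. i \<in> {1..n} \<Longrightarrow> j \<in> {1..n} \<Longrightarrow> i \<noteq> j \<Longrightarrow> d j i = - d i j"
    and clean_dir: "\<And>i j. (i, j) \<in> E0 \<Longrightarrow> d i j = (x i - x j) /\<^sub>R camera_dist x (i, j)"
  shows "true_scale x d t > 0"
    and "\<And>e. e \<in> tri_edges t \<Longrightarrow> true_scale x d t * height d t e = camera_dist x e"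
proof -
  obtain i j k where t_eq: "t = (i, j, k)" by (cases t)
  have ijk: "i \<in> {1..n}" "j \<in> {1..n}" "k \<in> {1..n}" "i < j" "j < k" "i < k"
    using t(1) by (auto simp: t_eq triples_def)
  define p where "p = x i - x j"
  define q where "q = x j - x k"
  have r: "x i - x k = p + q" by (simp add: p_def q_def)
  have len: "norm p > 0" "norm q > 0" "norm (p + q) > 0"
    using inj_onD[OF x, of i j] inj_onD[OF x, of j k] inj_onD[OF x, of i k] ijk
    by (auto simp: p_def q_def)
  \<comment> \<open>\<open>tri_edges t\<close> contains \<open>(i, k)\<close> and not
    \<open>(k, i)\<close>, so \<open>d k i\<close> comes from antisymmetry, with a sign.\<close>
  have d1: "d i j = p /\<^sub>R norm p" and d2: "d j k = q /\<^sub>R norm q"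
    and d3: "d k i = - ((p + q) /\<^sub>R norm (p + q))"
    using t(2) clean_dir antisym[of i k] ijk
    by (auto simp: t_eq camera_dist_def p_def[symmetric] q_def[symmetric] r)
  \<comment> \<open>Twice the area of the triangle, the same for every pair of sides.\<close>
  define K where "K = norm (cross3 p q)"
  have K': "norm (cross3 q p) = K"
    unfolding K_def by (subst cross_skew) simp
  have h1: "height d t (i, j) = K / (norm q * norm (p + q))"
    and h2: "height d t (j, k) = K / (norm (p + q) * norm p)"
    and h3: "height d t (i, k) = K / (norm p * norm q)"
    using ijk K' by (simp_all add: t_eq d1 d2 d3 cross_mult_left cross_mult_right
        cross_minus_left cross_minus_right cross_add_left cross_add_right
        K_def[symmetric] divide_simps)
  have "height d t (i, j) > 0" using t(3) by (auto simp: nondegenerate_def t_eq)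
  then have K: "K > 0" using len by (simp add: h1 zero_less_divide_iff mult_less_0_iff)
  \<comment> \<open>Law of sines: the heights are inversely proportional to the products of two side lengths.\<close>
  define s where "s = norm p * norm q * norm (p + q) / K"
  have "s > 0" using len K by (simp add: s_def)
  moreover have "s * height d t (i, j) = norm p" "s * height d t (j, k) = norm q"
    "s * height d t (i, k) = norm (p + q)"
    using len K by (simp_all add: s_def h1 h2 h3 del: height.simps norm_ge_zero)
  ultimately have s: "s > 0 \<and> (\<forall>e\<in>tri_edges t. s * height d t e = camera_dist x e)"
    by (simp add: t_eq camera_dist_def p_def[symmetric] q_def[symmetric] r del: height.simps)
  have "true_scale x d t = s"
    unfolding true_scale_def
  proof (rule the_equality)
    show "s > 0 \<and> (\<forall>e\<in>tri_edges t. s * height d t e = camera_dist x e)" by (fact s)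
  next
    fix s' assume s': "s' > 0 \<and> (\<forall>e\<in>tri_edges t. s' * height d t e = camera_dist x e)"
    have e: "(i, j) \<in> tri_edges t" by (simp add: t_eq)
    then have "s' * height d t (i, j) = s * height d t (i, j)" using s s' by metis
    then show "s' = s" using \<open>height d t (i, j) > 0\<close> by simp
  qed
  then show "true_scale x d t > 0"
    and "\<And>e. e \<in> tri_edges t \<Longrightarrow> true_scale x d t * height d t e = camera_dist x e"
    using s by auto
qed

section \<open>Comparison of a minimizer with its clean repair along the rows\<close>

lemma finite_retained: "finite (retained n d)"
  using finite_triples by (simp add: retained_def)

text \<open>\<open>C\<close> orients each adjacent pair of retained triples exactly once, so the
  ordered pairs are the disjoint union of \<open>C\<close> and its reversal.\<close>

lemma sum_rows:
  fixes G :: "triple \<Rightarrow> triple \<Rightarrow> real"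
  assumes rows: "row_set n d C"
  shows "(\<Sum>(t, u) | t \<in> retained n d \<and> u \<in> retained n d \<and> adjacent t u. G t u)
    = (\<Sum>(t, u)\<in>C. G t u + G u t)"
proof -
  have "C \<subseteq> retained n d \<times> retained n d"
    using rows by (auto simp: row_set_def)
  then have fC: "finite C" by (rule finite_subset) (simp add: finite_retained)
  have in_C: "(t, u) \<in> C \<or> (u, t) \<in> C \<longleftrightarrow> t \<in> retained n d \<and> u \<in> retained n d \<and> adjacent t u"
    and one: "\<not> ((t, u) \<in> C \<and> (u, t) \<in> C)" for t u
    using rows adjacent_sym[of t u] adjacent_sym[of u t] unfolding row_set_def by blast+
  have "{(t, u). t \<in> retained n d \<and> u \<in> retained n d \<and> adjacent t u} = C \<union> prod.swap ` C"
    unfolding set_eq_iff split_paired_All Un_iff mem_Collect_eq prod.case pair_in_swap_image in_C by blast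
  moreover have "C \<inter> prod.swap ` C = {}"
    unfolding set_eq_iff split_paired_All Int_iff pair_in_swap_image empty_iff using one by blast
  ultimately have "(\<Sum>(t, u) | t \<in> retained n d \<and> u \<in> retained n d \<and> adjacent t u. G t u)
    = (\<Sum>(t, u)\<in>C. G t u) + (\<Sum>(t, u)\<in>prod.swap ` C. G t u)"
    using fC by (simp add: sum.union_disjoint)
  also have "(\<Sum>(t, u)\<in>prod.swap ` C. G t u) = (\<Sum>(t, u)\<in>C. G u t)"
    by (subst sum.reindex) (auto simp: case_prod_unfold)
  finally show ?thesis by (simp add: sum.distrib[symmetric] case_prod_unfold)
qed

lemma exact_recovery_of_weights:
  assumes x: "inj_on x {1..n}"
    and part: "E0 \<union> Eb = complete_edges n"
    and antisym: "\<And>i j. i \<in> {1..n} \<Longrightarrow> j \<in> {1..n} \<Longrightarrow> i \<noteq> j \<Longrightarrow> d j i = - d i j"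
    and clean_dir: "\<And>i j. (i, j) \<in> E0 \<Longrightarrow> d i j = (x i - x j) /\<^sub>R camera_dist x (i, j)"
    and clean_nondeg: "\<And>t. t \<in> triples n \<Longrightarrow> clean E0 t \<Longrightarrow> nondegenerate d t"
    and rows: "row_set n d C"
    and w: "admissible_weights n E0 d C wg wb w"
    and gap: "wg * (real n / 2 - 6 * real (max_degree n Eb)) > 6 * wb * real (max_degree n Eb)"
  shows "exact_recovery n x E0 d C w"
  unfolding exact_recovery_def
proof (intro allI impI)
  fix z assume z: "is_arg_min (L1_objective d C w) (\<lambda>z. z \<in> retained n d \<rightarrow>\<^sub>E UNIV) z"
  let ?R = "retained n d" and ?T0 = "clean_retained n E0 d" and ?C0 = "clean_rows n E0 d C"
  let ?zs = "true_log_scale x d"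
  define \<Delta> where "\<Delta> = real (max_degree n Eb)"
  show "\<exists>\<alpha>. \<forall>t\<in>?T0. z t = ?zs t + \<alpha>"
  proof (cases "?T0 = {}")
    case False
    have T0R: "?T0 \<subseteq> ?R" and RT: "?R \<subseteq> triples n"
      by (auto simp: clean_retained_def retained_def)
    have fT0: "finite ?T0" using T0R finite_retained finite_subset by blast
    have C: "C \<subseteq> ?R \<times> ?R" and adjC: "\<And>t u. (t, u) \<in> C \<Longrightarrow> adjacent t u"
      using rows by (auto simp: row_set_def)
    have fC: "finite C" using C by (rule finite_subset) (simp add: finite_retained)
    have C0: "?C0 \<subseteq> C" by (auto simp: clean_rows_def)
    have scale: "true_scale x d t > 0"
      "\<And>e. e \<in> tri_edges t \<Longrightarrow> true_scale x d t * height d t e = camera_dist x e"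
      "\<And>e. e \<in> tri_edges t \<Longrightarrow> height d t e > 0" if "t \<in> ?T0" for t
    proof -
      have t: "t \<in> triples n" "tri_edges t \<subseteq> E0" "nondegenerate d t"
        using that by (auto simp: clean_retained_def retained_def clean_def)
      show "true_scale x d t > 0"
        "\<And>e. e \<in> tri_edges t \<Longrightarrow> true_scale x d t * height d t e = camera_dist x e"
        using true_scale[OF x t antisym clean_dir] by auto
      show "\<And>e. e \<in> tri_edges t \<Longrightarrow> height d t e > 0"
        using t(3) by (simp add: nondegenerate_def)
    qed
    \<comment> \<open>At the shared edge both scaled heights equal the same camera distance, so the
      logarithm of the height ratio is a difference of true log-scales.\<close>
    have residual_clean: "residual d y (t, u) = (y u - ?zs u) - (y t - ?zs t)"
      if tu: "(t, u) \<in> ?C0" for t u y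
    proof -
      have T0: "t \<in> ?T0" "u \<in> ?T0" and "adjacent t u"
        using tu adjC by (auto simp: clean_rows_def)
      let ?e = "shared_edge t u"
      have e: "?e \<in> tri_edges t" "?e \<in> tri_edges u"
        using shared_edge_in[of t n u] \<open>adjacent t u\<close> T0 T0R RT by blast+
      have "true_scale x d t * height d t ?e = true_scale x d u * height d u ?e"
        using scale(2) T0 e by simp
      then have ratio: "height d t ?e / height d u ?e = true_scale x d u / true_scale x d t"
        using scale(1)[OF T0(1)] scale(3)[OF T0(2) e(2)]
        by (simp add: frac_eq_eq mult.commute)
      then show ?thesis
        using scale(1)[OF T0(1)] scale(1)[OF T0(2)]
        by (simp add: residual_def ratio true_log_scale_def ln_divide_pos)
    qed
    \<comment> \<open>As clean triples are nondegenerate, the triples outside \<open>?T0\<close> are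
      exactly those that are not clean.\<close>
    have bad: "real (card {u \<in> triples n - ?T0. adjacent t u}) \<le> 6 * \<Delta>" if "t \<in> ?T0" for t
    proof -
      have "{u \<in> triples n - ?T0. adjacent t u} = {u \<in> triples n. \<not> clean E0 u \<and> adjacent t u}"
        using clean_nondeg unfolding clean_retained_def retained_def by blast
      moreover have "t \<in> triples n" "clean E0 t"
        using that by (auto simp: clean_retained_def retained_def)
      ultimately show ?thesis
        using card_corrupted_neighbours[OF part, of t] by (simp add: \<Delta>_def)
    qed
    define v where "v t = z t - ?zs t" for t
    have "?T0 \<subseteq> triples n" using T0R RT by blast
    \<comment> \<open>Vertices are deleted from the graph of all camera triples, retained or not,
      since the Poincare inequality holds for the full Johnson graph.\<close>
    from poincare_L1_vertex_deletion[OF finite_triples this False adjacent_sym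
        triples_poincare_L1 of_nat_0_le_iff bad, where v = v]
    obtain \<alpha> where \<alpha>: "(real n - 2 * (6 * \<Delta>)) * (\<Sum>t\<in>?T0. \<bar>v t - \<alpha>\<bar>)
      \<le> (\<Sum>(t, u) | t \<in> ?T0 \<and> u \<in> ?T0 \<and> adjacent t u. \<bar>v t - v u\<bar>)" by blast
    have fA: "finite {(t, u). t \<in> ?R \<and> u \<in> ?R \<and> adjacent t u}"
      by (rule finite_subset[of _ "?R \<times> ?R"]) (use finite_retained in auto)
    define M where "M = (\<Sum>t\<in>?T0. \<bar>v t - \<alpha>\<bar>)"
    define S where "S = (\<Sum>(t, u)\<in>?C0. \<bar>v u - v t\<bar>)"
    define z' where "z' t = (if t \<in> ?T0 then ?zs t + \<alpha> else z t)" for t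
    \<comment> \<open>The sum over ordered clean pairs visits each clean row twice; halving turns
      \<open>n - 12 * \<Delta>\<close> into \<open>n / 2 - 6 * \<Delta>\<close>.\<close>
    have "(\<Sum>(t, u) | t \<in> ?T0 \<and> u \<in> ?T0 \<and> adjacent t u. \<bar>v t - v u\<bar>)
      = (\<Sum>(t, u) | t \<in> ?R \<and> u \<in> ?R \<and> adjacent t u. if t \<in> ?T0 \<and> u \<in> ?T0 then \<bar>v t - v u\<bar> else 0)"
      by (rule sum.mono_neutral_cong_left[OF fA]) (use T0R in \<open>auto split: if_splits\<close>)
    also have "\<dots> = (\<Sum>(t, u)\<in>C. 2 * (if t \<in> ?T0 \<and> u \<in> ?T0 then \<bar>v u - v t\<bar> else 0))"
      unfolding sum_rows[OF rows] by (rule sum.cong) (auto simp: abs_minus_commute)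
    also have "\<dots> = (\<Sum>(t, u)\<in>?C0. 2 * \<bar>v u - v t\<bar>)"
      by (rule sum.mono_neutral_cong_right) (use fC in \<open>auto simp: clean_rows_def split: if_splits\<close>)
    also have "\<dots> = 2 * S"
      by (simp add: S_def sum_distrib_left case_prod_unfold)
    finally have expansion: "(real n / 2 - 6 * \<Delta>) * M \<le> S"
      using \<alpha> by (simp add: M_def algebra_simps)
    \<comment> \<open>\<open>H t u\<close> is the distance by which the endpoint \<open>t\<close>
      moves when only \<open>t\<close> lies in \<open>?T0\<close>. Over ordered pairs, each
      \<open>t\<close> in \<open>?T0\<close> is charged once per retained neighbour outside
      \<open>?T0\<close>, so at most \<open>6 * \<Delta>\<close> times.\<close>
    define H where "H t u = (if t \<in> ?T0 \<and> u \<notin> ?T0 then \<bar>v t - \<alpha>\<bar> else 0)" for t u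
    have "(\<Sum>(t, u)\<in>C - ?C0. H t u + H u t) \<le> (\<Sum>(t, u)\<in>C. H t u + H u t)"
      by (rule sum_mono2) (use fC in \<open>auto simp: H_def\<close>)
    also have "\<dots> = (\<Sum>(t, u) | t \<in> ?R \<and> u \<in> ?R \<and> adjacent t u. H t u)"
      by (rule sum_rows[OF rows, symmetric])
    also have "\<dots> = (\<Sum>(t, u)\<in>(SIGMA t:?T0. {u \<in> ?R - ?T0. adjacent t u}). \<bar>v t - \<alpha>\<bar>)"
      by (rule sum.mono_neutral_cong_right[OF fA])
         (use T0R in \<open>auto simp: H_def split: if_splits\<close>)
    also have "\<dots> = (\<Sum>t\<in>?T0. real (card {u \<in> ?R - ?T0. adjacent t u}) * \<bar>v t - \<alpha>\<bar>)"
      using fT0 finite_retained by (subst sum.Sigma[symmetric]) auto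
    also have "\<dots> \<le> (\<Sum>t\<in>?T0. 6 * \<Delta> * \<bar>v t - \<alpha>\<bar>)"
    proof (intro sum_mono mult_right_mono)
      fix t assume t: "t \<in> ?T0"
      have "card {u \<in> ?R - ?T0. adjacent t u} \<le> card {u \<in> triples n - ?T0. adjacent t u}"
        by (rule card_mono) (use RT finite_triples in auto)
      then show "real (card {u \<in> ?R - ?T0. adjacent t u}) \<le> 6 * \<Delta>"
        using bad[OF t] by linarith
    qed simp
    finally have corrupted: "(\<Sum>(t, u)\<in>C - ?C0. H t u + H u t) \<le> 6 * \<Delta> * M"
      by (simp add: M_def sum_distrib_left)
    have z'_diff: "\<bar>z' t - z t\<bar> = (if t \<in> ?T0 then \<bar>v t - \<alpha>\<bar> else 0)" for t
      unfolding z'_def v_def by auto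
    have wg: "wg > 0" and wb: "wb \<ge> 0" and wC0: "\<And>f. f \<in> ?C0 \<Longrightarrow> wg \<le> w f"
      and wCb: "\<And>f. f \<in> C - ?C0 \<Longrightarrow> 0 \<le> w f \<and> w f \<le> wb"
      using w unfolding admissible_weights_def by auto
    have split: "L1_objective d C w y = (\<Sum>f\<in>?C0. w f * \<bar>residual d y f\<bar>)
      + (\<Sum>f\<in>C - ?C0. w f * \<bar>residual d y f\<bar>)" for y
      using sum.subset_diff[OF C0 fC] by (simp add: L1_objective_def add.commute)
    \<comment> \<open>On \<open>?T0\<close> the competitor \<open>z'\<close> differs from the true
      log-scales by a constant, so all clean residuals vanish.\<close>
    have "(\<Sum>f\<in>?C0. w f * \<bar>residual d z' f\<bar>) = 0"
      by (rule sum.neutral) (auto simp: residual_clean z'_def clean_rows_def)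
    moreover have "(\<Sum>f\<in>C - ?C0. w f * \<bar>residual d z' f\<bar>)
      \<le> (\<Sum>f\<in>C - ?C0. w f * \<bar>residual d z f\<bar> + wb * (case f of (t, u) \<Rightarrow> H t u + H u t))"
    proof (rule sum_mono)
      fix f assume f: "f \<in> C - ?C0"
      obtain t u where tu: "f = (t, u)" by (cases f)
      \<comment> \<open>At most one endpoint of such a row moves, so its residual changes by no more
        than the \<open>H\<close> terms.\<close>
      have "t \<notin> ?T0 \<or> u \<notin> ?T0" using f by (auto simp: tu clean_rows_def)
      then have "H t u + H u t = \<bar>z' t - z t\<bar> + \<bar>z' u - z u\<bar>"
        unfolding z'_diff H_def by auto
      then have "\<bar>residual d z' f\<bar> \<le> \<bar>residual d z f\<bar> + (H t u + H u t)"
        by (simp add: tu residual_def)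
      then have "w f * \<bar>residual d z' f\<bar> \<le> w f * \<bar>residual d z f\<bar> + w f * (H t u + H u t)"
        using wCb[OF f] by (metis distrib_left mult_left_mono)
      also have "w f * (H t u + H u t) \<le> wb * (H t u + H u t)"
        using wCb[OF f] by (intro mult_right_mono) (auto simp: H_def)
      finally show "w f * \<bar>residual d z' f\<bar>
        \<le> w f * \<bar>residual d z f\<bar> + wb * (case f of (t, u) \<Rightarrow> H t u + H u t)"
        by (simp add: tu)
    qed
    moreover have "wb * (\<Sum>(t, u)\<in>C - ?C0. H t u + H u t) \<le> wb * (6 * \<Delta> * M)"
      using corrupted wb by (rule mult_left_mono)
    moreover have "wg * S \<le> (\<Sum>f\<in>?C0. w f * \<bar>residual d z f\<bar>)"
      unfolding S_def sum_distrib_left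
    proof (rule sum_mono)
      fix f assume f: "f \<in> ?C0"
      obtain t u where tu: "f = (t, u)" by (cases f)
      show "wg * (case f of (t, u) \<Rightarrow> \<bar>v u - v t\<bar>) \<le> w f * \<bar>residual d z f\<bar>"
        using f wC0[OF f] by (simp add: tu residual_clean v_def mult_right_mono)
    qed
    moreover have "L1_objective d C w z \<le> L1_objective d C w z'"
    proof -
      \<comment> \<open>\<open>z'\<close> differs from \<open>z\<close> only on retained triples, so
        it is still extensional and competes with the minimizer.\<close>
      have "z' \<in> ?R \<rightarrow>\<^sub>E UNIV"
        using z T0R by (auto simp: is_arg_min_def z'_def PiE_def extensional_def)
      then show ?thesis using z by (auto simp: is_arg_min_def not_less)
    qed
    ultimately have "wg * S \<le> wb * (6 * \<Delta> * M)"
      unfolding split by (simp add: sum.distrib sum_distrib_left)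
    moreover have "wg * ((real n / 2 - 6 * \<Delta>) * M) \<le> wg * S"
      using expansion wg by simp
    ultimately have "(wg * (real n / 2 - 6 * \<Delta>) - 6 * wb * \<Delta>) * M \<le> 0"
      by (simp add: algebra_simps)
    \<comment> \<open>The gap hypothesis says that the coefficient of \<open>M\<close> is
      positive.\<close>
    then have "M \<le> 0"
      using gap by (simp add: \<Delta>_def mult_le_0_iff)
    then have "\<forall>t\<in>?T0. \<bar>v t - \<alpha>\<bar> = 0"
      using fT0 sum_nonneg_eq_0_iff[of ?T0 "\<lambda>t. \<bar>v t - \<alpha>\<bar>"] sum_nonneg[of ?T0 "\<lambda>t. \<bar>v t - \<alpha>\<bar>"]
      unfolding M_def by fastforce
    then show ?thesis
      by (intro exI[of _ \<alpha>]) (auto simp: v_def)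
  qed simp
qed

theorem theoremH7:
  fixes n :: nat
    and x :: "nat \<Rightarrow> real^3"
    and E0 Eb :: "camera_edge set"
    and d :: "nat \<Rightarrow> nat \<Rightarrow> real^3"
    and C :: "row set"
  defines "\<Delta> \<equiv> real (max_degree n Eb)"
  assumes n_ge: "n \<ge> 4"
    and distinct: "inj_on x {1..n}"
    and partition: "E0 \<union> Eb = complete_edges n" "E0 \<inter> Eb = {}"
    and unit: "\<And>i j. i \<in> {1..n} \<Longrightarrow> j \<in> {1..n} \<Longrightarrow> i \<noteq> j \<Longrightarrow> norm (d i j) = 1"
    and antisym: "\<And>i j. i \<in> {1..n} \<Longrightarrow> j \<in> {1..n} \<Longrightarrow> i \<noteq> j \<Longrightarrow> d j i = - d i j"
    and clean_dir: "\<And>i j. (i, j) \<in> E0 \<Longrightarrow> d i j = (x i - x j) /\<^sub>R camera_dist x (i, j)"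
    and clean_nondeg: "\<And>t. t \<in> triples n \<Longrightarrow> clean E0 t \<Longrightarrow> nondegenerate d t"
    and rows: "row_set n d C"
  shows
    "(\<forall>wg wb w. admissible_weights n E0 d C wg wb w \<longrightarrow>
        (wg * (real n / 2 - 6 * \<Delta>) > 6 * wb * \<Delta> \<longleftrightarrow> \<Delta> / real n < wg / (12 * (wg + wb))) \<and>
        (wg * (real n / 2 - 6 * \<Delta>) > 6 * wb * \<Delta> \<longrightarrow> exact_recovery n x E0 d C w))
     \<and> (1 * (real n / 2 - 6 * \<Delta>) > 6 * 1 * \<Delta> \<longleftrightarrow> \<Delta> < real n / 24)
     \<and> admissible_weights n E0 d C 1 1 (\<lambda>f. 1)
     \<and> (\<Delta> < real n / 24 \<longrightarrow> exact_recovery n x E0 d C (\<lambda>f. 1))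
     \<and> (\<forall>p :: triple \<Rightarrow> real.
          (\<forall>t \<in> clean_retained n E0 d. p t = 1) \<and>
          (\<forall>t \<in> retained n d - clean_retained n E0 d. 0 \<le> p t \<and> p t \<le> 1) \<longrightarrow>
          admissible_weights n E0 d C 1 1 (\<lambda>(t, u). sqrt (p t * p u)) \<and>
          (\<Delta> < real n / 24 \<longrightarrow> exact_recovery n x E0 d C (\<lambda>(t, u). sqrt (p t * p u))))"
proof -
  have recovery: "exact_recovery n x E0 d C w"
    if "admissible_weights n E0 d C wg wb w" "wg * (real n / 2 - 6 * \<Delta>) > 6 * wb * \<Delta>" for wg wb w
    using exact_recovery_of_weights[OF distinct partition(1) antisym clean_dir clean_nondeg rows that(1)]
      that(2) by (simp add: \<Delta>_def)
  \<comment> \<open>With positive denominators cleared, both inequalities read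
    \<open>12 * (wg + wb) * \<Delta> < wg * n\<close>.\<close>
  have equiv: "wg * (real n / 2 - 6 * \<Delta>) > 6 * wb * \<Delta> \<longleftrightarrow> \<Delta> / real n < wg / (12 * (wg + wb))"
    if "admissible_weights n E0 d C wg wb w" for wg wb w
  proof -
    have "wg > 0" "wb \<ge> 0" using that by (auto simp: admissible_weights_def)
    then have "12 * (wg + wb) > 0" by simp
    moreover have "real n > 0" using n_ge by simp
    ultimately have "\<Delta> / real n < wg / (12 * (wg + wb)) \<longleftrightarrow> \<Delta> * (12 * (wg + wb)) < wg * real n"
      by (simp add: frac_less_eq divide_less_eq less_divide_eq mult.commute)
    then show ?thesis by (simp add: algebra_simps)
  qed
  have ones: "admissible_weights n E0 d C 1 1 (\<lambda>f. 1)"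
    by (simp add: admissible_weights_def)
  \<comment> \<open>On a clean row both factors are 1, so the weight is exactly 1; on any other row
    it lies between 0 and 1.\<close>
  have sqrts: "admissible_weights n E0 d C 1 1 (\<lambda>(t, u). sqrt (p t * p u))"
    if p: "\<forall>t \<in> clean_retained n E0 d. p t = 1"
      "\<forall>t \<in> retained n d - clean_retained n E0 d. 0 \<le> p t \<and> p t \<le> 1" for p :: "triple \<Rightarrow> real"
  proof -
    have p01: "0 \<le> p t \<and> p t \<le> 1" if "t \<in> retained n d" for t
      using p that by (cases "t \<in> clean_retained n E0 d") auto
    have "0 \<le> sqrt (p t * p u) \<and> sqrt (p t * p u) \<le> 1" if "(t, u) \<in> C" for t u
    proof -
      have "t \<in> retained n d" "u \<in> retained n d"
        using rows that by (auto simp: row_set_def)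
      then show ?thesis using p01[of t] p01[of u] by (simp add: mult_le_one)
    qed
    then show ?thesis
      using p(1) by (auto simp: admissible_weights_def clean_rows_def)
  qed
  have half: "1 * (real n / 2 - 6 * \<Delta>) > 6 * 1 * \<Delta> \<longleftrightarrow> \<Delta> < real n / 24"
    by auto
  show ?thesis
  proof (intro conjI allI impI)
    fix p :: "triple \<Rightarrow> real"
    assume "(\<forall>t \<in> clean_retained n E0 d. p t = 1) \<and>
      (\<forall>t \<in> retained n d - clean_retained n E0 d. 0 \<le> p t \<and> p t \<le> 1)"
    then show *: "admissible_weights n E0 d C 1 1 (\<lambda>(t, u). sqrt (p t * p u))"
      by (intro sqrts) simp_all
    show "exact_recovery n x E0 d C (\<lambda>(t, u). sqrt (p t * p u))" if "\<Delta> < real n / 24"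
      using recovery[OF *] half that by simp
  next
    show "exact_recovery n x E0 d C (\<lambda>f. 1)" if "\<Delta> < real n / 24"
      using recovery[OF ones] half that by simp
  next
    fix wg wb w
    assume *: "admissible_weights n E0 d C wg wb w"
    show "wg * (real n / 2 - 6 * \<Delta>) > 6 * wb * \<Delta> \<longleftrightarrow> \<Delta> / real n < wg / (12 * (wg + wb))"
      by (rule equiv[OF *])
    show "exact_recovery n x E0 d C w" if "wg * (real n / 2 - 6 * \<Delta>) > 6 * wb * \<Delta>"
      by (rule recovery[OF * that])
  qed (rule half ones)+
qed

end
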